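(* Let $P$ be a finite pure poset such that for all $0\leq i<j\leq \operatorname{rank}(P)$ the induced subposet of $P$ consisting of the height $i$ and height $j$ elements of $P$ is connected. If $P$ is not an ordinal sum of two (non-empty) induced subposets, then the comparability graph $\operatorname{comp}(P)$ is a uniquely partially orderable (UPO) graph.
   Context: A chain of a poset $P$ is a totally ordered subset; the length of a chain $C$ is $\#C-1$; $\operatorname{rank}(P)$ is the maximum of the lengths of chains in $P$. $P$ is pure if all maximal chains of $P$ have the same length. An induced subposet is a subset of $P$ with the restricted order. The height of $p\in P$ is the rank of the induced subposet $\{q\in P: q\leq p\}$. For posets $A,B$ on disjoint sets, the disjoint union $A+B$ is the poset on $A\cup B$ whose only relations are those of $A$ and those of $B$. A poset is disconnected if it can be written as a disjoint union of two (non-empty) posets, and connected otherwise. The ordinal sum $A\oplus B$ is the poset on $A\cup B$ in which $x\leq y$ iff either $x,y\in A$ and $x\leq y$ in $A$, or $x,y\in B$ and $x\leq y$ in $B$, or $x\in A$ and $y\in B$. The comparability graph $\operatorname{comp}(P)$ is the simple graph whose vertex set is the underlying set of $P$ and in which $\{x,y\}$ is an edge iff $x\neq y$ and $x,y$ are comparable in $P$ (i.e. $x\le y$ or $y\le x$). The dual poset $Q^{\partial}$ of $Q$ is the poset on the same set with the opposite order. A comparability graph $G$ is a uniquely partially orderable (UPO) graph if $G=\operatorname{comp}(P)=\operatorname{comp}(Q)$ for posets $P,Q$ implies $P=Q$ or $P=Q^{\partial}$. *)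

theory Defs
  imports Main
begin

text \<open>
  A poset is given by its order relation \<open>r\<close>, with \<^term>\<open>Partial_order r\<close>; by reflexivity \<open>r\<close>
  determines its underlying set \<^term>\<open>Field r\<close>, so equality of posets is equality of relations.
  The induced subposet on a set \<open>S\<close> is \<^term>\<open>Restr r S\<close> and the dual poset is \<^term>\<open>converse r\<close>.
\<close>

subsection \<open>Chains, rank, height\<close>

text \<open>Chains are the elements of \<^term>\<open>Chains r\<close> from the library:\<close>

lemma Chains_iff:
  assumes "Partial_order r"
  shows "C \<in> Chains r \<longleftrightarrow> C \<subseteq> Field r \<and> total_on C r"
proof
  assume "C \<in> Chains r"
  then show "C \<subseteq> Field r \<and> total_on C r"
    unfolding Chains_def total_on_def by (auto intro: FieldI1)
next
  assume C: "C \<subseteq> Field r \<and> total_on C r"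
  have refl: "(x, x) \<in> r" if "x \<in> C" for x
    using C that partial_order_onD(1)[OF assms] by (auto dest: refl_onD)
  show "C \<in> Chains r"
    unfolding Chains_def
  proof (intro CollectI ballI)
    fix x y assume "x \<in> C" "y \<in> C"
    then show "(x, y) \<in> r \<or> (y, x) \<in> r"
      using C refl by (cases "x = y") (auto simp: total_on_def)
  qed
qed

text \<open>Integer-valued: the empty chain has length \<open>-1\<close>, and so the empty poset has rank \<open>-1\<close>.\<close>

definition chain_length :: "'a set \<Rightarrow> int" where
  "chain_length C = int (card C) - 1"

definition poset_rank :: "'a rel \<Rightarrow> int" where
  "poset_rank r = Max (chain_length ` Chains r)"

definition maximal_chain :: "'a rel \<Rightarrow> 'a set \<Rightarrow> bool" where
  "maximal_chain r C \<longleftrightarrow> C \<in> Chains r \<and> (\<forall>D \<in> Chains r. C \<subseteq> D \<longrightarrow> D = C)"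

definition pure_poset :: "'a rel \<Rightarrow> bool" where
  "pure_poset r \<longleftrightarrow>
     (\<forall>C D. maximal_chain r C \<longrightarrow> maximal_chain r D \<longrightarrow> chain_length C = chain_length D)"

definition height :: "'a rel \<Rightarrow> 'a \<Rightarrow> int" where
  "height r p = poset_rank (Restr r {q \<in> Field r. (q, p) \<in> r})"

subsection \<open>Disjoint unions and ordinal sums\<close>

text \<open>Both operations are meant for posets with disjoint underlying sets.\<close>

definition disjoint_union :: "'a rel \<Rightarrow> 'a rel \<Rightarrow> 'a rel" where
  "disjoint_union a b = a \<union> b"

definition ordinal_sum :: "'a rel \<Rightarrow> 'a rel \<Rightarrow> 'a rel" where
  "ordinal_sum a b = a \<union> b \<union> Field a \<times> Field b"

definition disconnected_poset :: "'a rel \<Rightarrow> bool" where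
  "disconnected_poset r \<longleftrightarrow>
     (\<exists>a b. Partial_order a \<and> Partial_order b \<and> Field a \<noteq> {} \<and> Field b \<noteq> {} \<and>
        Field a \<inter> Field b = {} \<and> r = disjoint_union a b)"

definition connected_poset :: "'a rel \<Rightarrow> bool" where
  "connected_poset r \<longleftrightarrow> \<not> disconnected_poset r"

definition is_ordinal_sum :: "'a rel \<Rightarrow> bool" where
  "is_ordinal_sum r \<longleftrightarrow>
     (\<exists>S T. S \<subseteq> Field r \<and> T \<subseteq> Field r \<and> S \<noteq> {} \<and> T \<noteq> {} \<and> S \<inter> T = {} \<and>
        r = ordinal_sum (Restr r S) (Restr r T))"

subsection \<open>Comparability graphs\<close>

text \<open>A simple graph is the pair of its vertex set and its set of (two-element) edges.\<close>

type_synonym 'a graph = "'a set \<times> 'a set set"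

definition comp_graph :: "'a rel \<Rightarrow> 'a graph" where
  "comp_graph r = (Field r,
     {{x, y} | x y. x \<in> Field r \<and> y \<in> Field r \<and> x \<noteq> y \<and> ((x, y) \<in> r \<or> (y, x) \<in> r)})"

definition comparability_graph :: "'a graph \<Rightarrow> bool" where
  "comparability_graph G \<longleftrightarrow> (\<exists>p. Partial_order p \<and> G = comp_graph p)"

definition UPO :: "'a graph \<Rightarrow> bool" where
  "UPO G \<longleftrightarrow> comparability_graph G \<and>
     (\<forall>p q. Partial_order p \<longrightarrow> Partial_order q \<longrightarrow> G = comp_graph p \<longrightarrow> G = comp_graph q \<longrightarrow>
        p = q \<or> p = converse q)"

end

theory Submission
  imports Defs
begin

text \<open>
  Write \<open>L k\<close> for the set of elements of height \<open>k\<close>. By purity every maximal chain meets every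
  level exactly once, and each level is an antichain.

  Let \<open>q\<close> be a second order with the same comparability graph. If two comparabilities share an
  endpoint while their other endpoints are incomparable, then \<open>q\<close> must orient both alike, either
  towards or away from the shared endpoint, because transitivity would otherwise make the other
  two comparable. Between two levels \<open>L i\<close> and \<open>L j\<close> this situation arises at every shared
  endpoint, so connectedness makes \<open>q\<close> agree with the given order on all comparabilities between
  the two levels as soon as it agrees on one (\<open>upward_if_edge\<close>).

  It remains to compare different pairs of levels. If \<open>L k\<close> lay entirely below \<open>L (k + 1)\<close>, the
  poset would be the ordinal sum of its parts up to and above height \<open>k\<close>
  (\<open>consecutive_levels_incomplete\<close>). Hence consecutive levels contain an incomparable pair, and
  connectedness yields such a pair that has a common upper bound in the next level, and likewise
  a pair with a common lower bound in the previous level (\<open>incomparable_pair_with_bound\<close>). Each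
  pair is an instance of the forcing above, and together they carry the orientation from
  \<open>L k, L (k + 1)\<close> over \<open>L k, L (k + 2)\<close> to \<open>L (k + 1), L (k + 2)\<close> (\<open>upward_step\<close>). So \<open>q\<close> or its
  dual agrees with the given order on all consecutive levels, and saturated chains extend this to
  all comparabilities.
\<close>

section \<open>Connected posets\<close>

text \<open>
  This is connectedness of the comparability graph on \<open>S\<close>, in the form of an induction principle
  along comparabilities. Being symmetric in the order, it passes to the dual poset.
\<close>

definition linked :: "'a rel \<Rightarrow> 'a set \<Rightarrow> bool" where
  "linked r S \<longleftrightarrow>
     (\<forall>A \<subseteq> S. A \<noteq> {} \<longrightarrow> (\<forall>u \<in> A. \<forall>v \<in> S. (u, v) \<in> r \<or> (v, u) \<in> r \<longrightarrow> v \<in> A) \<longrightarrow> A = S)"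

lemma linkedD:
  assumes "linked r S" "A \<subseteq> S" "a \<in> A"
    and "\<And>u v. u \<in> A \<Longrightarrow> v \<in> S \<Longrightarrow> (u, v) \<in> r \<or> (v, u) \<in> r \<Longrightarrow> v \<in> A"
  shows "A = S"
  using assms unfolding linked_def by blast

lemma linked_converse: "linked (converse r) S \<longleftrightarrow> linked r S"
  unfolding linked_def by (simp add: disj_commute)

lemma Partial_order_reflD: "Partial_order r \<Longrightarrow> x \<in> Field r \<Longrightarrow> (x, x) \<in> r"
  by (auto simp: order_on_defs dest: refl_onD)

lemma Partial_order_transD: "Partial_order r \<Longrightarrow> (x, y) \<in> r \<Longrightarrow> (y, z) \<in> r \<Longrightarrow> (x, z) \<in> r"
  by (auto simp: order_on_defs dest: transD)

lemma Partial_order_antisymD: "Partial_order r \<Longrightarrow> (x, y) \<in> r \<Longrightarrow> (y, x) \<in> r \<Longrightarrow> x = y"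
  by (auto simp: order_on_defs dest: antisymD)

lemma Field_Restr_subset: "Partial_order r \<Longrightarrow> S \<subseteq> Field r \<Longrightarrow> Field (Restr r S) = S"
  using Partial_order_reflD by (fastforce simp: Field_def)

lemma linked_if_connected:
  assumes r: "Partial_order r" and S: "S \<subseteq> Field r" and conn: "connected_poset (Restr r S)"
  shows "linked r S"
  unfolding linked_def
proof (intro allI impI, rule ccontr)
  fix A assume A: "A \<subseteq> S" "A \<noteq> {}" "A \<noteq> S"
    and closed: "\<forall>u \<in> A. \<forall>v \<in> S. (u, v) \<in> r \<or> (v, u) \<in> r \<longrightarrow> v \<in> A"
  have F: "Field (Restr r A) = A" "Field (Restr r (S - A)) = S - A"
    using A(1) S by (intro Field_Restr_subset[OF r]; blast)+
  have ne: "A \<noteq> {}" "S - A \<noteq> {}" "A \<inter> (S - A) = {}" using A by blast+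
  have split: "Restr r S = disjoint_union (Restr r A) (Restr r (S - A))"
    using A closed unfolding disjoint_union_def by blast
  have "disconnected_poset (Restr r S)"
    unfolding disconnected_poset_def
    by (rule exI[of _ "Restr r A"], rule exI[of _ "Restr r (S - A)"],
        intro conjI split Partial_order_Restr[OF r]) (simp_all only: F ne not_False_eq_True)
  with conn show False by (simp add: connected_poset_def)
qed

text \<open>
  If no incomparable pair in \<open>X \<times> Y\<close> had a common bound in \<open>Z\<close>, then moving along a comparability
  between \<open>Y\<close> and \<open>Z\<close> would never change which elements of \<open>X\<close> lie below. Linkedness would then
  put every element of \<open>X\<close> that is below something in \<open>Y\<close> below all of \<open>Y\<close>.
\<close>

lemma incomparable_pair_with_bound:
  assumes trans: "trans r" and linked: "linked r (Y \<union> Z)"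
    and upward: "\<And>y z. y \<in> Y \<Longrightarrow> z \<in> Z \<Longrightarrow> (z, y) \<notin> r"
    and antichains: "\<And>u v. u \<in> Y \<and> v \<in> Y \<or> u \<in> Z \<and> v \<in> Z \<Longrightarrow> (u, v) \<in> r \<Longrightarrow> u = v"
    and below: "\<And>x. x \<in> X \<Longrightarrow> \<exists>y \<in> Y. (x, y) \<in> r"
    and incomplete: "x0 \<in> X" "y0 \<in> Y" "(x0, y0) \<notin> r"
  shows "\<exists>x \<in> X. \<exists>y \<in> Y. \<exists>z \<in> Z. (x, y) \<notin> r \<and> (x, z) \<in> r \<and> (y, z) \<in> r"
proof (rule ccontr)
  assume none: "\<not> ?thesis"
  \<comment> \<open>the part of the two levels above \<open>x0\<close>; it is closed under comparability\<close>
  let ?A = "{v \<in> Y \<union> Z. (x0, v) \<in> r}"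
  obtain y where "y \<in> ?A" using below[OF incomplete(1)] by blast
  moreover have "v \<in> ?A" if u: "u \<in> ?A" and v: "v \<in> Y \<union> Z" and uv: "(u, v) \<in> r \<or> (v, u) \<in> r" for u v
    using uv
  proof
    assume "(u, v) \<in> r"
    then show ?thesis using u v transD[OF trans] by blast
  next
    assume vu: "(v, u) \<in> r"
    show ?thesis
    proof (cases "v \<in> Y \<and> u \<in> Z")
      case True
      then show ?thesis using none incomplete(1) u vu by blast
    next
      case False
      then have "v = u" using u v vu upward antichains by blast
      then show ?thesis using u by simp
    qed
  qed
  ultimately have "?A = Y \<union> Z" by (intro linkedD[OF linked]) auto
  then show False using incomplete by blast
qed

section \<open>Heights in finite pure posets\<close>

lemma Chains_subset_Field: "C \<in> Chains r \<Longrightarrow> C \<subseteq> Field r"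
  unfolding Chains_def by (auto intro: FieldI1)

lemma finite_Chains: "finite (Field r) \<Longrightarrow> finite (Chains r)"
  using Chains_subset_Field by (metis PowI finite_Pow_iff rev_finite_subset subsetI)

lemma chain_length_le_rank: "finite (Field r) \<Longrightarrow> C \<in> Chains r \<Longrightarrow> chain_length C \<le> poset_rank r"
  unfolding poset_rank_def by (simp add: finite_Chains)

lemma ex_longest_chain:
  assumes "finite (Field r)"
  obtains C where "C \<in> Chains r" "chain_length C = poset_rank r"
proof -
  have "{} \<in> Chains r" by (simp add: Chains_def)
  then have "poset_rank r \<in> chain_length ` Chains r"
    unfolding poset_rank_def using finite_Chains[OF assms] by (intro Max_in) auto
  then show thesis using that by auto
qed

lemma maximal_chain_if_longest:
  assumes fin: "finite (Field r)" and C: "C \<in> Chains r"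
    and longest: "\<And>D. D \<in> Chains r \<Longrightarrow> C \<subseteq> D \<Longrightarrow> chain_length D \<le> chain_length C"
  shows "maximal_chain r C"
  unfolding maximal_chain_def
proof (intro conjI ballI impI C)
  fix D assume D: "D \<in> Chains r" "C \<subseteq> D"
  then have "finite D" using fin Chains_subset_Field finite_subset by metis
  then show "D = C"
    using D longest[of D] card_seteq[of D C] by (simp add: chain_length_def)
qed

lemma ex_maximal_chain_extending:
  assumes fin: "finite (Field r)" and C: "C \<in> Chains r"
  obtains M where "maximal_chain r M" "C \<subseteq> M"
proof -
  let ?K = "{D \<in> Chains r. C \<subseteq> D}"
  have K: "finite ?K" "?K \<noteq> {}" using finite_Chains[OF fin] C by auto
  have "Max (chain_length ` ?K) \<in> chain_length ` ?K" using K by (intro Max_in) auto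
  then obtain M where "M \<in> ?K" "chain_length M = Max (chain_length ` ?K)" by auto
  then have M: "M \<in> ?K" "\<And>D. D \<in> ?K \<Longrightarrow> chain_length D \<le> chain_length M"
    using K(1) by simp_all
  have "maximal_chain r M"
    using M by (intro maximal_chain_if_longest[OF fin]) auto
  then show thesis using that M(1) by blast
qed

lemma chain_length_maximal_chain:
  assumes fin: "finite (Field r)" and pure: "pure_poset r" and M: "maximal_chain r M"
  shows "chain_length M = poset_rank r"
proof -
  obtain C where C: "C \<in> Chains r" "chain_length C = poset_rank r"
    using ex_longest_chain[OF fin] .
  then have "maximal_chain r C"
    using chain_length_le_rank[OF fin] by (intro maximal_chain_if_longest[OF fin]) auto
  then show ?thesis using pure M C(2) unfolding pure_poset_def by metis
qed

lemma finite_Field_Restr: "finite (Field r) \<Longrightarrow> finite (Field (Restr r S))"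
  by (rule finite_subset[OF mono_Field]) auto

lemma height_nonneg:
  assumes "Partial_order r" "finite (Field r)" "p \<in> Field r"
  shows "0 \<le> height r p"
proof -
  have "{p} \<in> Chains (Restr r {q \<in> Field r. (q, p) \<in> r})"
    using assms Partial_order_reflD by (fastforce simp: Chains_def)
  from chain_length_le_rank[OF finite_Field_Restr[OF assms(2)] this]
  show ?thesis by (simp add: height_def chain_length_def)
qed

lemma height_le_rank:
  assumes "finite (Field r)"
  shows "height r p \<le> poset_rank r"
proof -
  obtain C where C: "C \<in> Chains (Restr r {q \<in> Field r. (q, p) \<in> r})" "chain_length C = height r p"
    using ex_longest_chain[OF finite_Field_Restr[OF assms]] unfolding height_def .
  from C(1) have "C \<in> Chains r" by (auto simp: Chains_def)
  then show ?thesis using chain_length_le_rank[OF assms] C(2) by metis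
qed

lemma height_strict_mono:
  assumes r: "Partial_order r" and fin: "finite (Field r)"
    and xy: "(x, y) \<in> r" "x \<noteq> y"
  shows "height r x < height r y"
proof -
  let ?D = "\<lambda>p. {q \<in> Field r. (q, p) \<in> r}"
  obtain C where C: "C \<in> Chains (Restr r (?D x))" "chain_length C = height r x"
    using ex_longest_chain[OF finite_Field_Restr[OF fin]] unfolding height_def .
  have below: "c \<in> Field r \<and> (c, x) \<in> r" if "c \<in> C" for c
    using C(1) that by (auto simp: Chains_def)
  have finC: "finite C" using below fin by (meson rev_finite_subset subsetI)
  have yC: "y \<notin> C" using below xy Partial_order_antisymD[OF r] by blast
  have "y \<in> Field r" using xy by (auto intro: FieldI2)
  then have "(y, y) \<in> r" using Partial_order_reflD[OF r] by blast
  moreover have "(c, y) \<in> r" if "c \<in> C" for c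
    using below[OF that] xy(1) Partial_order_transD[OF r] by blast
  ultimately have "insert y C \<in> Chains (Restr r (?D y))"
    using C(1) below \<open>y \<in> Field r\<close> by (auto simp: Chains_def)
  from chain_length_le_rank[OF finite_Field_Restr[OF fin] this]
  show ?thesis using C(2) finC yC by (simp add: height_def chain_length_def)
qed

text \<open>
  A maximal chain has one more element than the rank, and heights are distinct along it, so all
  heights occur.
\<close>

lemma ex_comparable_of_height:
  assumes r: "Partial_order r" and fin: "finite (Field r)" and pure: "pure_poset r"
    and xy: "(x, y) \<in> r" and k: "0 \<le> k" "k \<le> poset_rank r"
  obtains z where "z \<in> Field r" "height r z = k"
    "(x, z) \<in> r \<or> (z, x) \<in> r" "(y, z) \<in> r \<or> (z, y) \<in> r"
proof -
  have "{x, y} \<in> Chains r"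
    using xy Partial_order_reflD[OF r] by (auto simp: Chains_def intro: FieldI1 FieldI2)
  then obtain M where M: "maximal_chain r M" "{x, y} \<subseteq> M"
    using ex_maximal_chain_extending[OF fin] by metis
  then have chain: "M \<in> Chains r" by (simp add: maximal_chain_def)
  note sub = Chains_subset_Field[OF chain]
  have "inj_on (height r) M"
  proof (rule inj_onI, rule ccontr)
    fix a b assume ab: "a \<in> M" "b \<in> M" "height r a = height r b" "a \<noteq> b"
    then have "(a, b) \<in> r \<or> (b, a) \<in> r" using chain by (simp add: Chains_def)
    then show False
      using ab(3,4) height_strict_mono[OF r fin, of a b] height_strict_mono[OF r fin, of b a] by auto
  qed
  then have "card (height r ` M) = card {0..poset_rank r}"
    using chain_length_maximal_chain[OF fin pure M(1)]
    by (simp add: card_image chain_length_def)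
  moreover have "height r ` M \<subseteq> {0..poset_rank r}"
    using sub height_nonneg[OF r fin] height_le_rank[OF fin] by auto
  ultimately have "height r ` M = {0..poset_rank r}"
    by (intro card_subset_eq) auto
  then obtain z where "z \<in> M" "height r z = k" using k by force
  then show thesis using that[of z] M(2) chain sub unfolding Chains_def by blast
qed

section \<open>Orders with the same comparability graph\<close>

definition same_comparabilities :: "'a rel \<Rightarrow> 'a rel \<Rightarrow> bool" where
  "same_comparabilities r q \<longleftrightarrow> (\<forall>x y. (x, y) \<in> q \<or> (y, x) \<in> q \<longleftrightarrow> (x, y) \<in> r \<or> (y, x) \<in> r)"

lemma same_comparabilities_if_comp_graph_eq:
  assumes r: "Partial_order r" and q: "Partial_order q" and eq: "comp_graph r = comp_graph q"
  shows "same_comparabilities r q"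
proof -
  have edge: "{x, y} \<in> snd (comp_graph s) \<longleftrightarrow> x \<noteq> y \<and> ((x, y) \<in> s \<or> (y, x) \<in> s)" for s :: "'a rel" and x y
    unfolding comp_graph_def by (auto simp: doubleton_eq_iff intro: FieldI1 FieldI2)
  have F: "Field r = Field q" using eq by (simp add: comp_graph_def)
  show ?thesis
    unfolding same_comparabilities_def
  proof (intro allI)
    fix x y
    show "(x, y) \<in> q \<or> (y, x) \<in> q \<longleftrightarrow> (x, y) \<in> r \<or> (y, x) \<in> r"
    proof (cases "x = y")
      case True
      then show ?thesis
        using F Partial_order_reflD[OF r] Partial_order_reflD[OF q] by (auto intro: FieldI1)
    next
      case False
      then show ?thesis using edge[of x y r] edge[of x y q] eq by simp
    qed
  qed
qed

lemma same_comparabilities_converse: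
  "same_comparabilities r (converse q) \<longleftrightarrow> same_comparabilities r q"
  unfolding same_comparabilities_def by (simp add: disj_commute)

text \<open>
  A strictly larger order would have to contain a comparability in both directions.
\<close>

lemma eq_if_subset_same_comparabilities:
  assumes q: "Partial_order q" and same: "same_comparabilities r q" and sub: "r \<subseteq> q"
  shows "r = q"
proof (intro equalityI sub subrelI)
  fix x y assume xy: "(x, y) \<in> q"
  then have "(x, y) \<in> r \<or> (y, x) \<in> r" using same by (auto simp: same_comparabilities_def)
  then show "(x, y) \<in> r" using Partial_order_antisymD[OF q xy] sub by blast
qed

text \<open>
  The hypotheses hold when \<open>h\<close> is the height in a poset as in the theorem and \<open>n\<close> is its rank;
  the orientation argument uses the order and the heights through these properties alone.
\<close>

locale linked_levels =
  fixes r :: "'a rel" and h :: "'a \<Rightarrow> int" and n :: int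
  assumes order: "Partial_order r"
    and h_nonneg: "p \<in> Field r \<Longrightarrow> 0 \<le> h p"
    and h_le: "p \<in> Field r \<Longrightarrow> h p \<le> n"
    and h_strict_mono: "(x, y) \<in> r \<Longrightarrow> x \<noteq> y \<Longrightarrow> h x < h y"
    and ex_level: "(x, y) \<in> r \<Longrightarrow> 0 \<le> k \<Longrightarrow> k \<le> n \<Longrightarrow>
      \<exists>z \<in> Field r. h z = k \<and> ((x, z) \<in> r \<or> (z, x) \<in> r) \<and> ((y, z) \<in> r \<or> (z, y) \<in> r)"
    and linked_levels: "0 \<le> i \<Longrightarrow> i < j \<Longrightarrow> j \<le> n \<Longrightarrow> linked r {p \<in> Field r. h p = i \<or> h p = j}"
    and not_ordinal_sum: "\<not> is_ordinal_sum r"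
begin

definition level :: "int \<Rightarrow> 'a set" where
  "level k = {p \<in> Field r. h p = k}"

lemma linked_Un_levels: "0 \<le> i \<Longrightarrow> i < j \<Longrightarrow> j \<le> n \<Longrightarrow> linked r (level i \<union> level j)"
  using linked_levels[of i j] by (simp add: level_def Collect_disj_eq[symmetric] conj_disj_distribL)

lemma h_mono: "(x, y) \<in> r \<Longrightarrow> h x \<le> h y"
  using h_strict_mono by (cases "x = y") fastforce+

lemma comparable_upward:
  assumes "(x, y) \<in> r \<or> (y, x) \<in> r" "h x < h y"
  shows "(x, y) \<in> r"
  using assms h_mono[of y x] by auto

lemma level_antichain: "u \<in> level k \<Longrightarrow> v \<in> level k \<Longrightarrow> (u, v) \<in> r \<Longrightarrow> u = v"
  using h_strict_mono[of u v] by (auto simp: level_def)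

lemma ex_above:
  assumes "x \<in> Field r" "h x \<le> k" "k \<le> n"
  obtains y where "y \<in> level k" "(x, y) \<in> r"
proof -
  have "(x, x) \<in> r" by (rule Partial_order_reflD[OF order assms(1)])
  then obtain y where y: "y \<in> level k" "(x, y) \<in> r \<or> (y, x) \<in> r"
    using ex_level[of x x k] h_nonneg[OF assms(1)] assms(2,3) by (auto simp: level_def)
  moreover have "(x, y) \<in> r" if "(y, x) \<in> r"
    using that y(1) h_strict_mono[OF that] assms(2) by (cases "x = y") (auto simp: level_def)
  ultimately show thesis using that by blast
qed

lemma ex_below:
  assumes "x \<in> Field r" "k \<le> h x" "0 \<le> k"
  obtains y where "y \<in> level k" "(y, x) \<in> r"
proof -
  have "(x, x) \<in> r" by (rule Partial_order_reflD[OF order assms(1)])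
  then obtain y where y: "y \<in> level k" "(x, y) \<in> r \<or> (y, x) \<in> r"
    using ex_level[of x x k] h_le[OF assms(1)] assms(2,3) by (auto simp: level_def)
  moreover have "(y, x) \<in> r" if "(x, y) \<in> r"
    using that y(1) h_strict_mono[OF that] assms(2) by (cases "x = y") (auto simp: level_def)
  ultimately show thesis using that by blast
qed

lemma level_nonempty:
  assumes "Field r \<noteq> {}" "0 \<le> k" "k \<le> n"
  shows "level k \<noteq> {}"
proof -
  obtain x where "x \<in> Field r" using assms(1) by blast
  then show ?thesis
    using ex_above[of x k] ex_below[of x k] assms(2,3) by (cases "h x \<le> k") auto
qed

text \<open>
  Every element of height at most \<open>k\<close> is below some element of height \<open>k\<close>, and dually above;
  so if two consecutive levels were completely related, then everything up to height \<open>k\<close> would be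
  below everything above it, which is an ordinal sum.
\<close>

lemma consecutive_levels_incomplete:
  assumes ne: "Field r \<noteq> {}" and k: "0 \<le> k" "k + 1 \<le> n"
  obtains x y where "x \<in> level k" "y \<in> level (k + 1)" "(x, y) \<notin> r"
proof (rule ccontr)
  assume "\<not> thesis"
  then have complete: "(a, b) \<in> r" if "a \<in> level k" "b \<in> level (k + 1)" for a b
    using that \<open>\<And>x y. x \<in> level k \<Longrightarrow> y \<in> level (k + 1) \<Longrightarrow> (x, y) \<notin> r \<Longrightarrow> thesis\<close> by blast
  let ?S = "{p \<in> Field r. h p \<le> k}" and ?T = "{p \<in> Field r. k < h p}"
  have ne': "?S \<noteq> {}" "?T \<noteq> {}"
    using level_nonempty[OF ne, of k] level_nonempty[OF ne, of "k + 1"] k by (auto simp: level_def)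
  have F: "Field (Restr r ?S) = ?S" "Field (Restr r ?T) = ?T"
    by (rule Field_Restr_subset[OF order], blast)+
  have "(x, y) \<in> r" if x: "x \<in> ?S" and y: "y \<in> ?T" for x y
  proof -
    obtain a where a: "a \<in> level k" "(x, a) \<in> r"
      using x k ex_above[of x k] by auto
    obtain b where b: "b \<in> level (k + 1)" "(b, y) \<in> r"
      using y k ex_below[of y "k + 1"] by auto
    show ?thesis
      using Partial_order_transD[OF order] a(2) complete[OF a(1) b(1)] b(2) by blast
  qed
  then have "?S \<times> ?T \<subseteq> r" by blast
  moreover have "(x, y) \<in> Restr r ?S \<union> Restr r ?T \<union> ?S \<times> ?T" if "(x, y) \<in> r" for x y
    using that h_mono[OF that] FieldI1[OF that] FieldI2[OF that] by auto
  ultimately have "r = Restr r ?S \<union> Restr r ?T \<union> ?S \<times> ?T"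
    by (intro equalityI subrelI) blast+
  then have sum: "r = ordinal_sum (Restr r ?S) (Restr r ?T)" unfolding ordinal_sum_def F .
  have "is_ordinal_sum r"
    unfolding is_ordinal_sum_def by (rule exI[of _ ?S], rule exI[of _ ?T], intro conjI ne' sum) auto
  then show False using not_ordinal_sum by blast
qed

lemma incomparable_pair_with_upper_bound:
  assumes ne: "Field r \<noteq> {}" and k: "0 \<le> k" "k + 2 \<le> n"
  obtains x y z where "x \<in> level k" "y \<in> level (k + 1)" "z \<in> level (k + 2)"
    "(x, y) \<notin> r" "(y, x) \<notin> r" "(x, z) \<in> r" "(y, z) \<in> r"
proof -
  obtain x0 y0 where xy0: "x0 \<in> level k" "y0 \<in> level (k + 1)" "(x0, y0) \<notin> r"
    using consecutive_levels_incomplete[OF ne, of k] k by auto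
  have "\<exists>x \<in> level k. \<exists>y \<in> level (k + 1). \<exists>z \<in> level (k + 2).
          (x, y) \<notin> r \<and> (x, z) \<in> r \<and> (y, z) \<in> r"
  proof (rule incomparable_pair_with_bound[OF _ _ _ _ _ xy0])
    show "trans r" using order by (simp add: order_on_defs)
    show "linked r (level (k + 1) \<union> level (k + 2))" using k by (intro linked_Un_levels) auto
    show "(z, y) \<notin> r" if "y \<in> level (k + 1)" "z \<in> level (k + 2)" for y z
      using that h_mono[of z y] by (auto simp: level_def)
    show "\<exists>y \<in> level (k + 1). (x, y) \<in> r" if "x \<in> level k" for x
      using that k ex_above[of x "k + 1"] by (auto simp: level_def)
  qed (use level_antichain in blast)
  then show thesis using that h_mono by (fastforce simp: level_def)
qed

lemma incomparable_pair_with_lower_bound: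
  assumes ne: "Field r \<noteq> {}" and k: "0 \<le> k" "k + 2 \<le> n"
  obtains x y z where "x \<in> level k" "y \<in> level (k + 1)" "z \<in> level (k + 2)"
    "(y, z) \<notin> r" "(z, y) \<notin> r" "(x, y) \<in> r" "(x, z) \<in> r"
proof -
  obtain y0 z0 where yz0: "y0 \<in> level (k + 1)" "z0 \<in> level (k + 2)" "(y0, z0) \<notin> r"
    using consecutive_levels_incomplete[OF ne, of "k + 1"] k by (auto simp: add.commute)
  have "\<exists>z \<in> level (k + 2). \<exists>y \<in> level (k + 1). \<exists>x \<in> level k.
          (z, y) \<notin> r\<inverse> \<and> (z, x) \<in> r\<inverse> \<and> (y, x) \<in> r\<inverse>"
  proof (rule incomparable_pair_with_bound)
    show "trans (r\<inverse>)" using order by (simp add: order_on_defs)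
    show "linked (r\<inverse>) (level (k + 1) \<union> level k)"
      using k linked_Un_levels[of k "k + 1"] by (simp add: linked_converse Un_commute)
    show "(x, y) \<notin> r\<inverse>" if "y \<in> level (k + 1)" "x \<in> level k" for x y
      using that h_mono[of y x] by (auto simp: level_def)
    show "\<exists>y \<in> level (k + 1). (z, y) \<in> r\<inverse>" if "z \<in> level (k + 2)" for z
      using that k ex_below[of z "k + 1"] by (auto simp: level_def)
    show "(z0, y0) \<notin> r\<inverse>" using yz0 by simp
  qed (use yz0 level_antichain in blast)+
  then show thesis using that h_mono by (fastforce simp: level_def)
qed

definition upward :: "'a rel \<Rightarrow> int \<Rightarrow> int \<Rightarrow> bool" where
  "upward q i j \<longleftrightarrow> (\<forall>x \<in> level i. \<forall>y \<in> level j. (x, y) \<in> r \<longrightarrow> (x, y) \<in> q)"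

text \<open>
  Both forcing rules hold because the opposite orientation of the second comparability would,
  by transitivity of \<open>q\<close>, make \<open>x\<close> and \<open>y\<close> comparable. Allowing \<open>x = y\<close> lets the rules apply to
  any two elements of one level.
\<close>

lemma forced_from_common_upper:
  assumes q: "Partial_order q" and same: "same_comparabilities r q"
    and "(x, y) \<in> r \<or> (y, x) \<in> r \<Longrightarrow> x = y" "(x, z) \<in> q" "(y, z) \<in> r"
  shows "(y, z) \<in> q"
  using assms Partial_order_transD[OF q, of x z y] unfolding same_comparabilities_def by metis

lemma forced_from_common_lower:
  assumes q: "Partial_order q" and same: "same_comparabilities r q"
    and "(x, y) \<in> r \<or> (y, x) \<in> r \<Longrightarrow> x = y" "(z, x) \<in> q" "(z, y) \<in> r"
  shows "(z, y) \<in> q"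
  using assms Partial_order_transD[OF q, of y z x] unfolding same_comparabilities_def by metis

text \<open>
  Within two levels the endpoints of upward comparabilities are closed under comparability: at
  such an endpoint, every other comparability is forced to be upward as well. So every element of
  both levels is such an endpoint, and forcing once more covers all comparabilities.
\<close>

lemma upward_if_edge:
  assumes q: "Partial_order q" and same: "same_comparabilities r q"
    and ij: "0 \<le> i" "i < j" "j \<le> n"
    and edge: "x0 \<in> level i" "y0 \<in> level j" "(x0, y0) \<in> r" "(x0, y0) \<in> q"
  shows "upward q i j"
proof -
  have right: "(x, y') \<in> q"
    if "y \<in> level j" "y' \<in> level j" "(x, y) \<in> q" "(x, y') \<in> r" for x y y'
    using forced_from_common_lower[OF q same _ that(3,4)] level_antichain that(1,2) by metis
  have left: "(x', y) \<in> q"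
    if "x \<in> level i" "x' \<in> level i" "(x, y) \<in> q" "(x', y) \<in> r" for x x' y
    using forced_from_common_upper[OF q same _ that(3,4)] level_antichain that(1,2) by metis
  let ?X = "{x \<in> level i. \<exists>y \<in> level j. (x, y) \<in> r \<and> (x, y) \<in> q}"
  let ?Y = "{y \<in> level j. \<exists>x \<in> level i. (x, y) \<in> r \<and> (x, y) \<in> q}"
  have disj: "u \<notin> level j" if "u \<in> level i" for u
    using that ij(2) by (auto simp: level_def)
  have "?X \<union> ?Y = level i \<union> level j"
  proof (rule linkedD[OF linked_Un_levels[OF ij]])
    show "x0 \<in> ?X \<union> ?Y" using edge by blast
    fix u v
    assume u: "u \<in> ?X \<union> ?Y" and v: "v \<in> level i \<union> level j" and uv: "(u, v) \<in> r \<or> (v, u) \<in> r"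
    consider "u \<in> ?X" "v \<in> level i" | "u \<in> ?X" "v \<in> level j"
      | "u \<in> ?Y" "v \<in> level i" | "u \<in> ?Y" "v \<in> level j"
      using u v by blast
    then show "v \<in> ?X \<union> ?Y"
    proof cases
      case 1
      then have "u = v" using uv level_antichain by blast
      then show ?thesis using 1 by blast
    next
      case 2
      then have "(u, v) \<in> r" using uv ij(2) by (intro comparable_upward) (auto simp: level_def)
      then have "(u, v) \<in> q" using 2 right by blast
      then show ?thesis using 2 \<open>(u, v) \<in> r\<close> by blast
    next
      case 3
      then have "(v, u) \<in> r" using uv ij(2) by (intro comparable_upward) (auto simp: level_def)
      then have "(v, u) \<in> q" using 3 left by blast
      then show ?thesis using 3 \<open>(v, u) \<in> r\<close> by blast
    next
      case 4
      then have "u = v" using uv level_antichain by blast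
      then show ?thesis using 4 by blast
    qed
  qed blast
  then have "level i \<subseteq> ?X" using disj by blast
  then show ?thesis unfolding upward_def using right by blast
qed

lemma upward_or_upward_converse:
  assumes q: "Partial_order q" and same: "same_comparabilities r q"
    and ij: "0 \<le> i" "i < j" "j \<le> n"
  shows "upward q i j \<or> upward (q\<inverse>) i j"
proof (cases "\<exists>x \<in> level i. \<exists>y \<in> level j. (x, y) \<in> r \<and> (x, y) \<in> q")
  case True
  then show ?thesis using upward_if_edge[OF q same ij] by blast
next
  case False
  then show ?thesis using same unfolding upward_def same_comparabilities_def converse_iff by blast
qed

text \<open>
  The incomparable pair with a lower bound \<open>x\<close> links \<open>L k, L (k + 1)\<close> to \<open>L k, L (k + 2)\<close>, because
  the two comparabilities share \<open>x\<close>; the pair with an upper bound does the second half.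
\<close>

lemma upward_step:
  assumes q: "Partial_order q" and same: "same_comparabilities r q"
    and ne: "Field r \<noteq> {}" and k: "0 \<le> k" "k + 2 \<le> n" and up: "upward q k (k + 1)"
  shows "upward q (k + 1) (k + 2)"
proof -
  obtain x y z where lower: "x \<in> level k" "y \<in> level (k + 1)" "z \<in> level (k + 2)"
    "(y, z) \<notin> r" "(z, y) \<notin> r" "(x, y) \<in> r" "(x, z) \<in> r"
    using incomparable_pair_with_lower_bound[OF ne k] .
  have "(x, y) \<in> q" using up lower unfolding upward_def by blast
  then have "(x, z) \<in> q"
    using lower by (intro forced_from_common_lower[OF q same, of y z x]) auto
  with lower k have skip: "upward q k (k + 2)"
    by (intro upward_if_edge[OF q same, of k "k + 2" x z]) auto
  obtain x y z where upper: "x \<in> level k" "y \<in> level (k + 1)" "z \<in> level (k + 2)"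
    "(x, y) \<notin> r" "(y, x) \<notin> r" "(x, z) \<in> r" "(y, z) \<in> r"
    using incomparable_pair_with_upper_bound[OF ne k] .
  have "(x, z) \<in> q" using skip upper unfolding upward_def by blast
  then have "(y, z) \<in> q"
    using upper by (intro forced_from_common_upper[OF q same, of x y z]) auto
  with upper k show ?thesis
    by (intro upward_if_edge[OF q same, of "k + 1" "k + 2" y z]) auto
qed

lemma eq_if_upward:
  assumes q: "Partial_order q" and same: "same_comparabilities r q"
    and up: "1 \<le> n \<Longrightarrow> upward q 0 1"
  shows "r = q"
proof -
  have consecutive: "upward q (int m) (int m + 1)" if "Field r \<noteq> {}" "int m + 1 \<le> n" for m
    using that
  proof (induction m)
    case 0
    then show ?case using up by simp
  next
    case (Suc m)
    then show ?case using upward_step[OF q same, of "int m"] by (simp add: add.commute)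
  qed
  have refl: "(x, x) \<in> q" if "x \<in> Field r" for x
    using Partial_order_reflD[OF order that] same by (auto simp: same_comparabilities_def)
  have "(x, y) \<in> r \<Longrightarrow> (x, y) \<in> q" for x y
  proof (induction "nat (h y - h x)" arbitrary: x rule: less_induct)
    case less
    have F: "x \<in> Field r" "y \<in> Field r" using less.prems by (auto intro: FieldI1 FieldI2)
    show ?case
    proof (cases "x = y")
      case True
      then show ?thesis using refl F by simp
    next
      case False
      then have hxy: "h x < h y" using h_strict_mono less.prems by blast
      have bounds: "0 \<le> h x" "h x + 1 \<le> n" using h_nonneg[OF F(1)] h_le[OF F(2)] hxy by auto
      obtain z where z: "z \<in> Field r" "h z = h x + 1"
        "(x, z) \<in> r \<or> (z, x) \<in> r" "(y, z) \<in> r \<or> (z, y) \<in> r"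
        using ex_level[OF less.prems, of "h x + 1"] bounds by auto
      have xz: "(x, z) \<in> r" using z by (intro comparable_upward) auto
      have zy: "(z, y) \<in> r"
        using z hxy h_strict_mono[of y z] by (cases "y = z") auto
      have "upward q (h x) (h x + 1)" using consecutive[of "nat (h x)"] F bounds by auto
      then have "(x, z) \<in> q" using xz F(1) z(1,2) by (auto simp: upward_def level_def)
      moreover have "(z, y) \<in> q" using less.hyps[of z] zy z(2) hxy by auto
      ultimately show ?thesis using Partial_order_transD[OF q] by blast
    qed
  qed
  then show ?thesis by (intro eq_if_subset_same_comparabilities[OF q same] subrelI)
qed

lemma eq_or_eq_converse:
  assumes q: "Partial_order q" and same: "same_comparabilities r q"
  shows "r = q \<or> r = q\<inverse>"
proof -
  have q': "Partial_order (q\<inverse>)" and same': "same_comparabilities r (q\<inverse>)"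
    using q same by (simp_all add: same_comparabilities_converse)
  show ?thesis
    using upward_or_upward_converse[OF q same, of 0 1] eq_if_upward[OF q same]
      eq_if_upward[OF q' same'] by auto
qed

end

theorem theorem1p2:
  fixes P :: "'a rel"
  assumes poset: "Partial_order P"
    and fin: "finite (Field P)"
    and pure: "pure_poset P"
    and conn: "\<And>i j. 0 \<le> i \<Longrightarrow> i < j \<Longrightarrow> j \<le> poset_rank P \<Longrightarrow>
           connected_poset (Restr P {p \<in> Field P. height P p = i \<or> height P p = j})"
    and not_sum: "\<not> is_ordinal_sum P"
  shows "UPO (comp_graph P)"
proof -
  interpret linked_levels P "height P" "poset_rank P"
  proof
    show "\<exists>z \<in> Field P. height P z = k \<and> ((x, z) \<in> P \<or> (z, x) \<in> P) \<and> ((y, z) \<in> P \<or> (z, y) \<in> P)"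
      if "(x, y) \<in> P" "0 \<le> k" "k \<le> poset_rank P" for x y k
      using ex_comparable_of_height[OF poset fin pure that] by metis
    show "linked P {p \<in> Field P. height P p = i \<or> height P p = j}"
      if "0 \<le> i" "i < j" "j \<le> poset_rank P" for i j
      by (rule linked_if_connected[OF poset _ conn[OF that]]) blast
  qed (use poset not_sum height_nonneg[OF poset fin] height_le_rank[OF fin]
      height_strict_mono[OF poset fin] in auto)
  have two: "q = P \<or> q = P\<inverse>" if "Partial_order q" "comp_graph P = comp_graph q" for q
    using eq_or_eq_converse[OF that(1) same_comparabilities_if_comp_graph_eq[OF poset that]] by auto
  show ?thesis
    unfolding UPO_def comparability_graph_def using poset two by (metis converse_converse)
qed

end
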